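(* Let $K$ be an arbitrary field, let $A$ be a central simple countably generated $K$-algebra, and let $\sigma\in\operatorname{Aut}_K(A)$ be a $K$-algebra automorphism. With $A_i$, $n_i$, $e_j$, $a_{ij\nu}$, $b_{ij\nu}$, $N_{ij}$ fixed as in the context, for each $a\in A$, $$\sigma^{-1}(a)=\sum_{j=1}^{n_i}p'_{ij}(a)\,e_j\qquad\text{for all } i\gg 0,$$ where $p'_{ij}(\cdot)=\sum_{\nu\in N_{ij}}\sigma(a_{ij\nu})\,(\cdot)\,\sigma(b_{ij\nu}):A\to A$.
   Context: Algebras are associative with $1$. A central simple $K$-algebra is a simple $K$-algebra $A$ (no proper nonzero two-sided ideals), possibly infinite dimensional, whose centre is $K$. Since $A$ is countably generated, $A=\bigcup_{i\ge 0}A_i$ for an ascending chain $K\subseteq A_0\subseteq A_1\subseteq\cdots$ of finite dimensional subspaces; fix such a chain. Fix a $K$-basis $e_1:=1,e_2,\ldots$ of $A$ such that for each $i\ge 0$ the elements $e_1,\ldots,e_{n_i}$ form a $K$-basis of $A_i$. For each $i\ge 0$ and $1\le j\le n_i$ let $p_{ij}:A_i\to A_i$ be the $K$-linear map $\sum_{k=1}^{n_i}\lambda_ke_k\mapsto\lambda_je_1=\lambda_j$ ($\lambda_k\in K$). By the Density Theorem there are finitely many elements $a_{ij\nu},b_{ij\nu}\in A$ ($\nu\in N_{ij}$, $N_{ij}$ a finite set) with $p_{ij}(a)=\sum_{\nu\in N_{ij}}a_{ij\nu}\,a\,b_{ij\nu}$ for all $a\in A_i$; fix such elements. "$i\gg0$"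 means for all sufficiently large $i$ (depending on $a$). *)

theory Defs
  imports Complex_Main "HOL-Library.Countable_Set"
begin

locale k_algebra = vector_space scale
  for scale :: "'k::field \<Rightarrow> 'a::ring_1 \<Rightarrow> 'a" (infixr \<open>*s\<close> 75) +
  assumes scale_mult_left: "(c *s x) * y = c *s (x * y)"
    and scale_mult_right: "x * (c *s y) = c *s (x * y)"
begin

definition ground :: "'a set"
  where "ground = range (\<lambda>c. c *s 1)"

definition subalgebra :: "'a set \<Rightarrow> bool"
  where "subalgebra B \<longleftrightarrow> subspace B \<and> 1 \<in> B \<and> (\<forall>x\<in>B. \<forall>y\<in>B. x * y \<in> B)"

definition countably_generated :: bool
  where "countably_generated \<longleftrightarrow> (\<exists>S. countable S \<and> subalgebra hull S = UNIV)"

definition two_sided_ideal :: "'a set \<Rightarrow> bool"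
  where "two_sided_ideal I \<longleftrightarrow>
    0 \<in> I \<and> (\<forall>x\<in>I. \<forall>y\<in>I. x + y \<in> I) \<and> (\<forall>x\<in>I. \<forall>r. r * x \<in> I \<and> x * r \<in> I)"

definition centre :: "'a set"
  where "centre = {z. \<forall>x. z * x = x * z}"

text \<open>The algebra is nonzero because the class \<^class>\<open>ring_1\<close> contains \<^prop>\<open>0 \<noteq> 1\<close>.\<close>

definition central_simple :: bool
  where "central_simple \<longleftrightarrow>
    (\<forall>I. two_sided_ideal I \<longrightarrow> I = {0} \<or> I = UNIV) \<and> centre = ground"

definition algebra_automorphism :: "('a \<Rightarrow> 'a) \<Rightarrow> bool"
  where "algebra_automorphism \<sigma> \<longleftrightarrow>
    bij \<sigma> \<and> \<sigma> 1 = 1 \<and> (\<forall>x y. \<sigma> (x + y) = \<sigma> x + \<sigma> y) \<and>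
    (\<forall>x y. \<sigma> (x * y) = \<sigma> x * \<sigma> y) \<and> (\<forall>c x. \<sigma> (c *s x) = c *s \<sigma> x)"

definition finite_dim :: "'a set \<Rightarrow> bool"
  where "finite_dim V \<longleftrightarrow> (\<exists>B. finite B \<and> span B = V)"

definition exhausting_chain :: "(nat \<Rightarrow> 'a set) \<Rightarrow> bool"
  where "exhausting_chain V \<longleftrightarrow>
    (\<forall>i. subspace (V i) \<and> finite_dim (V i) \<and> V i \<subseteq> V (Suc i)) \<and>
    ground \<subseteq> V 0 \<and> (\<Union>i. V i) = UNIV"

definition basis_family :: "(nat \<Rightarrow> 'a) \<Rightarrow> nat set \<Rightarrow> 'a set \<Rightarrow> bool"
  where "basis_family e J V \<longleftrightarrow> inj_on e J \<and> independent (e ` J) \<and> span (e ` J) = V"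

text \<open>
  The basis is indexed from 1. Its index set \<open>J\<close> is \<open>{1..}\<close> or, when the algebra
  is finite dimensional, \<open>{1..d}\<close>; values of \<open>e\<close> outside \<open>J\<close> are irrelevant.
\<close>

definition adapted_basis ::
    "(nat \<Rightarrow> 'a set) \<Rightarrow> (nat \<Rightarrow> nat) \<Rightarrow> (nat \<Rightarrow> 'a) \<Rightarrow> nat set \<Rightarrow> bool"
  where "adapted_basis V n e J \<longleftrightarrow>
    (J = {1..} \<or> (\<exists>d. J = {1..d})) \<and> basis_family e J UNIV \<and> e 1 = 1 \<and>
    (\<forall>i. {1..n i} \<subseteq> J \<and> basis_family e {1..n i} (V i))"

text \<open>
  \<open>coord_proj e m j\<close> maps \<open>\<Sum>k=1..m. \<lambda>\<^sub>k *s e k\<close> to \<open>\<lambda>\<^sub>j *s e 1\<close>. It is meant for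
  arguments in the span of \<open>e 1, \<dots>, e m\<close> only.
\<close>

definition coord_proj :: "(nat \<Rightarrow> 'a) \<Rightarrow> nat \<Rightarrow> nat \<Rightarrow> 'a \<Rightarrow> 'a"
  where "coord_proj e m j a = representation (e ` {1..m}) a (e j) *s e 1"

end

end

theory Submission
  imports Defs
begin

text \<open>
  Put \<open>y = inv \<sigma> x\<close>. As the chain exhausts the algebra, \<open>y\<close> lies in \<open>V i\<close> for all large \<open>i\<close>,
  and there the multiplication operator with coefficients \<open>a i j \<nu>\<close> and \<open>b i j \<nu>\<close> sends \<open>y\<close> to
  its \<open>j\<close>-th coordinate, which is a scalar. Applying \<open>\<sigma>\<close> to this identity twists the
  coefficients by \<open>\<sigma>\<close>, replaces \<open>y\<close> by \<open>\<sigma> y = x\<close>, and leaves the scalar alone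
  (\<open>twisted_coord_proj\<close>). The twisted operators evaluated at \<open>x\<close> are thus exactly the
  coordinates of \<open>inv \<sigma> x\<close>, and the basis expansion (\<open>coord_proj_expansion\<close>) recovers
  \<open>inv \<sigma> x\<close> from them.
\<close>

context k_algebra
begin

text \<open>
  Coordinate projections take values in the ground field, sitting in the algebra as multiples
  of \<open>e 1 = 1\<close>; so multiplying such a value by \<open>e j\<close> in the algebra is scalar multiplication.
\<close>

lemma coord_proj_expansion:
  assumes basis: "basis_family e {1..m} W" and unit: "e 1 = 1" and y: "y \<in> W"
  shows "(\<Sum>j=1..m. coord_proj e m j y * e j) = y"
proof -
  have inj: "inj_on e {1..m}" and ind: "independent (e ` {1..m})"
    and span: "y \<in> span (e ` {1..m})"
    using basis y by (auto simp: basis_family_def)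
  (* The simplifier turns 1 :: nat into Suc 0, so the equation for e 1 is put in that form. *)
  have "(\<Sum>j=1..m. coord_proj e m j y * e j)
      = (\<Sum>j=1..m. representation (e ` {1..m}) y (e j) *s e j)"
    by (simp add: coord_proj_def unit[simplified] scale_mult_left)
  also have "\<dots> = (\<Sum>v\<in>e ` {1..m}. representation (e ` {1..m}) y v *s v)"
    using inj by (simp add: sum.reindex)
  also have "\<dots> = y"
    using ind span by (intro sum_representation_eq) auto
  finally show ?thesis .
qed

lemma automorphism_sum:
  assumes "algebra_automorphism \<sigma>"
  shows "\<sigma> (\<Sum>i\<in>I. f i) = (\<Sum>i\<in>I. \<sigma> (f i))"
proof -
  have add: "\<sigma> (u + v) = \<sigma> u + \<sigma> v" for u v
    using assms by (simp add: algebra_automorphism_def)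
  have zero: "\<sigma> 0 = 0"
    using add[of 0 0] by simp
  show ?thesis
    by (induction I rule: infinite_finite_induct) (simp_all add: add zero)
qed

text \<open>An automorphism fixes scalars, hence fixes every value of a coordinate projection.\<close>

lemma twisted_coord_proj:
  assumes aut: "algebra_automorphism \<sigma>" and unit: "e 1 = 1"
    and proj: "coord_proj e m j y = (\<Sum>\<nu>\<in>N. a \<nu> * y * b \<nu>)"
  shows "(\<Sum>\<nu>\<in>N. \<sigma> (a \<nu>) * \<sigma> y * \<sigma> (b \<nu>)) = coord_proj e m j y"
proof -
  have "(\<Sum>\<nu>\<in>N. \<sigma> (a \<nu>) * \<sigma> y * \<sigma> (b \<nu>)) = \<sigma> (\<Sum>\<nu>\<in>N. a \<nu> * y * b \<nu>)"
    using aut by (simp add: automorphism_sum algebra_automorphism_def)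
  also have "\<dots> = \<sigma> (coord_proj e m j y)"
    by (simp only: proj)
  also have "\<dots> = coord_proj e m j y"
    using aut unit by (simp add: coord_proj_def algebra_automorphism_def)
  finally show ?thesis .
qed

lemma exhausting_chain_eventually_mem:
  assumes "exhausting_chain V"
  shows "\<forall>\<^sub>F i in sequentially. y \<in> V i"
proof -
  have "y \<in> (\<Union>i. V i)" and step: "\<And>i. V i \<subseteq> V (Suc i)"
    using assms by (auto simp: exhausting_chain_def)
  then obtain i0 where "y \<in> V i0"
    by blast
  then have "y \<in> V i" if "i0 \<le> i" for i
    using lift_Suc_mono_le[of V, OF step that] by blast
  then show ?thesis
    by (auto simp: eventually_sequentially)
qed

end

theorem theorem5p1:
  fixes scale :: "'k::field \<Rightarrow> 'a::ring_1 \<Rightarrow> 'a"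
    and \<sigma> :: "'a \<Rightarrow> 'a"
    and V :: "nat \<Rightarrow> 'a set"
    and n :: "nat \<Rightarrow> nat"
    and e :: "nat \<Rightarrow> 'a"
    and J :: "nat set"
    and N :: "nat \<Rightarrow> nat \<Rightarrow> 'i set"
    and a b :: "nat \<Rightarrow> nat \<Rightarrow> 'i \<Rightarrow> 'a"
  assumes "k_algebra scale"
    and "k_algebra.central_simple scale"
    and "k_algebra.countably_generated scale"
    and "k_algebra.algebra_automorphism scale \<sigma>"
    and "k_algebra.exhausting_chain scale V"
    and "k_algebra.adapted_basis scale V n e J"
    and "\<And>i j. j \<in> {1..n i} \<Longrightarrow> finite (N i j)"
    and "\<And>i j x. j \<in> {1..n i} \<Longrightarrow> x \<in> V i \<Longrightarrow>
           k_algebra.coord_proj scale e (n i) j x = (\<Sum>\<nu>\<in>N i j. a i j \<nu> * x * b i j \<nu>)"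
  shows "\<forall>x. \<forall>\<^sub>F i in sequentially.
           inv \<sigma> x = (\<Sum>j=1..n i. (\<Sum>\<nu>\<in>N i j. \<sigma> (a i j \<nu>) * x * \<sigma> (b i j \<nu>)) * e j)"
proof
  fix x
  interpret k_algebra scale
    by (rule assms(1))
  note aut = assms(4)
  have unit: "e 1 = 1" and basis: "\<And>i. basis_family e {1..n i} (V i)"
    using assms(6) by (simp_all add: adapted_basis_def)
  define y where "y = inv \<sigma> x"
  have x: "\<sigma> y = x"
    using aut by (simp add: y_def algebra_automorphism_def bij_is_surj surj_f_inv_f)
  have "\<forall>\<^sub>F i in sequentially. y \<in> V i"
    by (rule exhausting_chain_eventually_mem[OF assms(5)])
  then show "\<forall>\<^sub>F i in sequentially.
      inv \<sigma> x = (\<Sum>j=1..n i. (\<Sum>\<nu>\<in>N i j. \<sigma> (a i j \<nu>) * x * \<sigma> (b i j \<nu>)) * e j)"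
  proof eventually_elim
    case (elim i)
    have "(\<Sum>\<nu>\<in>N i j. \<sigma> (a i j \<nu>) * x * \<sigma> (b i j \<nu>)) = coord_proj e (n i) j y"
      if "j \<in> {1..n i}" for j
      using twisted_coord_proj[where a = "a i j" and b = "b i j", OF aut unit assms(8)[OF that elim]]
      by (simp add: x)
    then show ?case
      using coord_proj_expansion[OF basis unit elim] by (simp add: y_def)
  qed
qed

end
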